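(* Let $L$ be a finite modular lattice with top element $1$ and at least two elements. Then $L$ is $1$-distributive if and only if $L$ has no $1$-sublattice isomorphic to any of the lattices $M_3$, $M_{3,2}$, $M_{3,4}$.
   Context: $1$-distributive: a lattice $L$ with top $1$ is $1$-distributive if for all $a,b,c\in L$, $a\vee b=1$ implies $c\wedge(a\vee b)=(c\wedge a)\vee(c\wedge b)$. $1$-sublattice: a sublattice of $L$ (closed under $\wedge$ and $\vee$ of $L$) that contains the top element $1$ of $L$. The three lattices are given by their covering relations ($x\prec y$ means $y$ covers $x$): $M_3$ (5 elements $o,p,q,r,1$): $o\prec p,q,r$ and $p,q,r\prec 1$. $M_{3,2}$ (7 elements $o,p,q,r,s,t,1$): $o\prec p,q,r$; $p,q,r\prec s$; $p\prec t$; $s\prec 1$; $t\prec 1$. $M_{3,4}$ (10 elements $o,p,q,r,s,t,u,v,w,1$): $o\prec p,q,r$; $p,q,r\prec s$; $p\prec t$; $r\prec u$; $s\prec v$; $t\prec v$; $s\prec w$; $u\prec w$; $v\prec 1$; $w\prec 1$. In each case the element denoted $1$ is the top element. *)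

theory Defs
  imports Main
begin

unbundle lattice_syntax

text \<open>A lattice is represented by a type of class \<^class>\<open>lattice\<close>; properties of the lattice as a whole
  take the type as an argument of type \<^typ>\<open>'a itself\<close>.\<close>

definition modular_lattice :: "'a::lattice itself \<Rightarrow> bool" where
  "modular_lattice _ \<longleftrightarrow>
     (\<forall>a b c :: 'a. a \<le> c \<longrightarrow> a \<squnion> (b \<sqinter> c) = (a \<squnion> b) \<sqinter> c)"

definition one_distributive :: "'a::bounded_lattice_top itself \<Rightarrow> bool" where
  "one_distributive _ \<longleftrightarrow>
     (\<forall>a b c :: 'a. a \<squnion> b = \<top> \<longrightarrow> c \<sqinter> (a \<squnion> b) = (c \<sqinter> a) \<squnion> (c \<sqinter> b))"

definition one_sublattice :: "'a::bounded_lattice_top set \<Rightarrow> bool" where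
  "one_sublattice S \<longleftrightarrow>
     (\<forall>x\<in>S. \<forall>y\<in>S. x \<sqinter> y \<in> S \<and> x \<squnion> y \<in> S) \<and> \<top> \<in> S"

text \<open>The sublattice \<open>S\<close> of \<open>'a\<close> is isomorphic to the whole lattice \<open>'b\<close>.\<close>

definition sublattice_isomorphic :: "'a::lattice set \<Rightarrow> 'b::lattice itself \<Rightarrow> bool" where
  "sublattice_isomorphic S _ \<longleftrightarrow>
     (\<exists>f. bij_betw f S (UNIV :: 'b set) \<and>
          (\<forall>x\<in>S. \<forall>y\<in>S. f (x \<sqinter> y) = f x \<sqinter> f y \<and> f (x \<squnion> y) = f x \<squnion> f y))"

text \<open>Each of the three lattices below is a datatype ordered by the reflexive transitive closure of
  its covering relation; a pair \<open>(x, y)\<close> in that relation means that \<open>y\<close> covers \<open>x\<close>. Meets and joins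
  are defined as greatest lower and least upper bounds of this order.\<close>

lemma rtrancl_succs:
  "(x, y) \<in> R\<^sup>* \<longleftrightarrow> x = y \<or> (\<exists>z \<in> R `` {x}. (z, y) \<in> R\<^sup>*)"
  by (meson Image_singleton_iff converse_rtranclE converse_rtrancl_into_rtrancl rtrancl.rtrancl_refl)

datatype M3 = M3_o | M3_p | M3_q | M3_r | M3_1

definition M3_covers :: "(M3 \<times> M3) set" where
  "M3_covers =
     {(M3_o, M3_p), (M3_o, M3_q), (M3_o, M3_r),
      (M3_p, M3_1),
      (M3_q, M3_1),
      (M3_r, M3_1)}"

lemma UNIV_M3:
  "UNIV =
     {M3_o, M3_p, M3_q, M3_r, M3_1}"
  by (rule set_eqI, case_tac x) simp_all

lemma M3_forall:
  "(\<forall>x. P x) \<longleftrightarrow>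
     P M3_o \<and> P M3_p \<and> P M3_q \<and> P M3_r \<and> P M3_1"
  by (simp flip: ball_UNIV add: UNIV_M3)

lemma M3_exists:
  "(\<exists>x. P x) \<longleftrightarrow>
     P M3_o \<or> P M3_p \<or> P M3_q \<or> P M3_r \<or> P M3_1"
  by (simp flip: bex_UNIV add: UNIV_M3)

lemma M3_succs:
  "M3_covers `` {M3_o} = {M3_p, M3_q, M3_r}"
  "M3_covers `` {M3_p} = {M3_1}"
  "M3_covers `` {M3_q} = {M3_1}"
  "M3_covers `` {M3_r} = {M3_1}"
  "M3_covers `` {M3_1} = {}"
  by (auto simp: M3_covers_def)

lemma M3_above_1:
  "(M3_1, y) \<in> M3_covers\<^sup>* \<longleftrightarrow>
     y \<in> {M3_1}"
  by (subst rtrancl_succs) (auto simp: M3_succs)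

lemma M3_above_r:
  "(M3_r, y) \<in> M3_covers\<^sup>* \<longleftrightarrow>
     y \<in> {M3_r, M3_1}"
  by (subst rtrancl_succs) (auto simp: M3_succs M3_above_1)

lemma M3_above_q:
  "(M3_q, y) \<in> M3_covers\<^sup>* \<longleftrightarrow>
     y \<in> {M3_q, M3_1}"
  by (subst rtrancl_succs) (auto simp: M3_succs M3_above_1)

lemma M3_above_p:
  "(M3_p, y) \<in> M3_covers\<^sup>* \<longleftrightarrow>
     y \<in> {M3_p, M3_1}"
  by (subst rtrancl_succs) (auto simp: M3_succs M3_above_1)

lemma M3_above_o:
  "(M3_o, y) \<in> M3_covers\<^sup>* \<longleftrightarrow>
     y \<in> {M3_o, M3_p, M3_q, M3_r, M3_1}"
  by (subst rtrancl_succs) (auto simp: M3_succs M3_above_p M3_above_q M3_above_r)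

lemmas M3_above =
  M3_above_1 M3_above_r M3_above_q M3_above_p M3_above_o

instantiation M3 :: order
begin

definition less_eq_M3 :: "M3 \<Rightarrow> M3 \<Rightarrow> bool" where
  "x \<le> y \<longleftrightarrow> (x, y) \<in> M3_covers\<^sup>*"

definition less_M3 :: "M3 \<Rightarrow> M3 \<Rightarrow> bool" where
  "x < y \<longleftrightarrow> x \<le> y \<and> \<not> y \<le> (x :: M3)"

instance
proof
  fix x y :: M3
  show "x \<le> y \<Longrightarrow> y \<le> x \<Longrightarrow> x = y"
    unfolding less_eq_M3_def by (cases x; cases y; simp add: M3_above)
qed (auto simp: less_eq_M3_def less_M3_def)

end

lemma M3_inf_exists: "\<exists>z::M3. z \<le> x \<and> z \<le> y \<and> (\<forall>w. w \<le> x \<and> w \<le> y \<longrightarrow> w \<le> z)"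
  by (cases x; cases y; simp add: M3_forall M3_exists less_eq_M3_def M3_above)

lemma M3_sup_exists: "\<exists>z::M3. x \<le> z \<and> y \<le> z \<and> (\<forall>w. x \<le> w \<and> y \<le> w \<longrightarrow> z \<le> w)"
  by (cases x; cases y; simp add: M3_forall M3_exists less_eq_M3_def M3_above)

instantiation M3 :: bounded_lattice_top
begin

definition inf_M3 :: "M3 \<Rightarrow> M3 \<Rightarrow> M3" where
  "x \<sqinter> (y :: M3) = (GREATEST z. z \<le> x \<and> z \<le> y)"

definition sup_M3 :: "M3 \<Rightarrow> M3 \<Rightarrow> M3" where
  "x \<squnion> (y :: M3) = (LEAST z. x \<le> z \<and> y \<le> z)"

definition top_M3 :: M3 where
  "\<top> = M3_1"

instance
proof
  fix x y z :: M3
  have glb: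
    "x \<sqinter> y \<le> x \<and> x \<sqinter> y \<le> y \<and> (\<forall>w. w \<le> x \<and> w \<le> y \<longrightarrow> w \<le> x \<sqinter> y)" for x y :: M3
    using M3_inf_exists[of x y] unfolding inf_M3_def 
    by (metis (mono_tags, lifting) Greatest_equality)
  have lub:
    "x \<le> x \<squnion> y \<and> y \<le> x \<squnion> y \<and> (\<forall>w. x \<le> w \<and> y \<le> w \<longrightarrow> x \<squnion> y \<le> w)" for x y :: M3
    using M3_sup_exists[of x y] unfolding sup_M3_def 
    by (metis (mono_tags, lifting) Least_equality)
  show "x \<sqinter> y \<le> x" "x \<sqinter> y \<le> y"
    using glb by blast+
  show "x \<le> y \<Longrightarrow> x \<le> z \<Longrightarrow> x \<le> y \<sqinter> z"
    using glb by blast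
  show "x \<le> x \<squnion> y" "y \<le> x \<squnion> y"
    using lub by blast+
  show "y \<le> x \<Longrightarrow> z \<le> x \<Longrightarrow> y \<squnion> z \<le> x"
    using lub by blast
  show "x \<le> \<top>"
    unfolding top_M3_def less_eq_M3_def by (cases x; simp add: M3_above)
qed

end

datatype M32 = M32_o | M32_p | M32_q | M32_r | M32_s | M32_t | M32_1

definition M32_covers :: "(M32 \<times> M32) set" where
  "M32_covers =
     {(M32_o, M32_p), (M32_o, M32_q), (M32_o, M32_r),
      (M32_p, M32_s), (M32_p, M32_t),
      (M32_q, M32_s),
      (M32_r, M32_s),
      (M32_s, M32_1),
      (M32_t, M32_1)}"

lemma UNIV_M32:
  "UNIV =
     {M32_o, M32_p, M32_q, M32_r, M32_s,
      M32_t, M32_1}"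
  by (rule set_eqI, case_tac x) simp_all

lemma M32_forall:
  "(\<forall>x. P x) \<longleftrightarrow>
     P M32_o \<and> P M32_p \<and> P M32_q \<and> P M32_r \<and> P M32_s \<and>
     P M32_t \<and> P M32_1"
  by (simp flip: ball_UNIV add: UNIV_M32)

lemma M32_exists:
  "(\<exists>x. P x) \<longleftrightarrow>
     P M32_o \<or> P M32_p \<or> P M32_q \<or> P M32_r \<or> P M32_s \<or>
     P M32_t \<or> P M32_1"
  by (simp flip: bex_UNIV add: UNIV_M32)

lemma M32_succs:
  "M32_covers `` {M32_o} = {M32_p, M32_q, M32_r}"
  "M32_covers `` {M32_p} = {M32_s, M32_t}"
  "M32_covers `` {M32_q} = {M32_s}"
  "M32_covers `` {M32_r} = {M32_s}"
  "M32_covers `` {M32_s} = {M32_1}"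
  "M32_covers `` {M32_t} = {M32_1}"
  "M32_covers `` {M32_1} = {}"
  by (auto simp: M32_covers_def)

lemma M32_above_1:
  "(M32_1, y) \<in> M32_covers\<^sup>* \<longleftrightarrow>
     y \<in> {M32_1}"
  by (subst rtrancl_succs) (auto simp: M32_succs)

lemma M32_above_t:
  "(M32_t, y) \<in> M32_covers\<^sup>* \<longleftrightarrow>
     y \<in> {M32_t, M32_1}"
  by (subst rtrancl_succs) (auto simp: M32_succs M32_above_1)

lemma M32_above_s:
  "(M32_s, y) \<in> M32_covers\<^sup>* \<longleftrightarrow>
     y \<in> {M32_s, M32_1}"
  by (subst rtrancl_succs) (auto simp: M32_succs M32_above_1)

lemma M32_above_r:
  "(M32_r, y) \<in> M32_covers\<^sup>* \<longleftrightarrow>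
     y \<in> {M32_r, M32_s, M32_1}"
  by (subst rtrancl_succs) (auto simp: M32_succs M32_above_s)

lemma M32_above_q:
  "(M32_q, y) \<in> M32_covers\<^sup>* \<longleftrightarrow>
     y \<in> {M32_q, M32_s, M32_1}"
  by (subst rtrancl_succs) (auto simp: M32_succs M32_above_s)

lemma M32_above_p:
  "(M32_p, y) \<in> M32_covers\<^sup>* \<longleftrightarrow>
     y \<in> {M32_p, M32_s, M32_t, M32_1}"
  by (subst rtrancl_succs) (auto simp: M32_succs M32_above_s M32_above_t)

lemma M32_above_o:
  "(M32_o, y) \<in> M32_covers\<^sup>* \<longleftrightarrow>
     y \<in> {M32_o, M32_p, M32_q, M32_r, M32_s, M32_t, M32_1}"
  by (subst rtrancl_succs) (auto simp: M32_succs M32_above_p M32_above_q M32_above_r)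

lemmas M32_above =
  M32_above_1 M32_above_t M32_above_s M32_above_r M32_above_q
  M32_above_p M32_above_o

instantiation M32 :: order
begin

definition less_eq_M32 :: "M32 \<Rightarrow> M32 \<Rightarrow> bool" where
  "x \<le> y \<longleftrightarrow> (x, y) \<in> M32_covers\<^sup>*"

definition less_M32 :: "M32 \<Rightarrow> M32 \<Rightarrow> bool" where
  "x < y \<longleftrightarrow> x \<le> y \<and> \<not> y \<le> (x :: M32)"

instance
proof
  fix x y :: M32
  show "x \<le> y \<Longrightarrow> y \<le> x \<Longrightarrow> x = y"
    unfolding less_eq_M32_def by (cases x; cases y; simp add: M32_above)
qed (auto simp: less_eq_M32_def less_M32_def)

end

lemma M32_inf_exists: "\<exists>z::M32. z \<le> x \<and> z \<le> y \<and> (\<forall>w. w \<le> x \<and> w \<le> y \<longrightarrow> w \<le> z)"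
  by (cases x; cases y; simp add: M32_forall M32_exists less_eq_M32_def M32_above)

lemma M32_sup_exists: "\<exists>z::M32. x \<le> z \<and> y \<le> z \<and> (\<forall>w. x \<le> w \<and> y \<le> w \<longrightarrow> z \<le> w)"
  by (cases x; cases y; simp add: M32_forall M32_exists less_eq_M32_def M32_above)

instantiation M32 :: bounded_lattice_top
begin

definition inf_M32 :: "M32 \<Rightarrow> M32 \<Rightarrow> M32" where
  "x \<sqinter> (y :: M32) = (GREATEST z. z \<le> x \<and> z \<le> y)"

definition sup_M32 :: "M32 \<Rightarrow> M32 \<Rightarrow> M32" where
  "x \<squnion> (y :: M32) = (LEAST z. x \<le> z \<and> y \<le> z)"

definition top_M32 :: M32 where
  "\<top> = M32_1"

instance
proof
  fix x y z :: M32
  have glb: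
    "x \<sqinter> y \<le> x \<and> x \<sqinter> y \<le> y \<and> (\<forall>w. w \<le> x \<and> w \<le> y \<longrightarrow> w \<le> x \<sqinter> y)" for x y :: M32
    using M32_inf_exists[of x y] unfolding inf_M32_def 
    by (metis (mono_tags, lifting) Greatest_equality)
  have lub:
    "x \<le> x \<squnion> y \<and> y \<le> x \<squnion> y \<and> (\<forall>w. x \<le> w \<and> y \<le> w \<longrightarrow> x \<squnion> y \<le> w)" for x y :: M32
    using M32_sup_exists[of x y] unfolding sup_M32_def 
    by (metis (mono_tags, lifting) Least_equality)
  show "x \<sqinter> y \<le> x" "x \<sqinter> y \<le> y"
    using glb by blast+
  show "x \<le> y \<Longrightarrow> x \<le> z \<Longrightarrow> x \<le> y \<sqinter> z"
    using glb by blast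
  show "x \<le> x \<squnion> y" "y \<le> x \<squnion> y"
    using lub by blast+
  show "y \<le> x \<Longrightarrow> z \<le> x \<Longrightarrow> y \<squnion> z \<le> x"
    using lub by blast
  show "x \<le> \<top>"
    unfolding top_M32_def less_eq_M32_def by (cases x; simp add: M32_above)
qed

end

datatype M34 = M34_o | M34_p | M34_q | M34_r | M34_s | M34_t | M34_u | M34_v | M34_w | M34_1

definition M34_covers :: "(M34 \<times> M34) set" where
  "M34_covers =
     {(M34_o, M34_p), (M34_o, M34_q), (M34_o, M34_r),
      (M34_p, M34_s), (M34_p, M34_t),
      (M34_q, M34_s),
      (M34_r, M34_s), (M34_r, M34_u),
      (M34_s, M34_v), (M34_s, M34_w),
      (M34_t, M34_v),
      (M34_u, M34_w),
      (M34_v, M34_1),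
      (M34_w, M34_1)}"

lemma UNIV_M34:
  "UNIV =
     {M34_o, M34_p, M34_q, M34_r, M34_s,
      M34_t, M34_u, M34_v, M34_w, M34_1}"
  by (rule set_eqI, case_tac x) simp_all

lemma M34_forall:
  "(\<forall>x. P x) \<longleftrightarrow>
     P M34_o \<and> P M34_p \<and> P M34_q \<and> P M34_r \<and> P M34_s \<and>
     P M34_t \<and> P M34_u \<and> P M34_v \<and> P M34_w \<and> P M34_1"
  by (simp flip: ball_UNIV add: UNIV_M34)

lemma M34_exists:
  "(\<exists>x. P x) \<longleftrightarrow>
     P M34_o \<or> P M34_p \<or> P M34_q \<or> P M34_r \<or> P M34_s \<or>
     P M34_t \<or> P M34_u \<or> P M34_v \<or> P M34_w \<or> P M34_1"
  by (simp flip: bex_UNIV add: UNIV_M34)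

lemma M34_succs:
  "M34_covers `` {M34_o} = {M34_p, M34_q, M34_r}"
  "M34_covers `` {M34_p} = {M34_s, M34_t}"
  "M34_covers `` {M34_q} = {M34_s}"
  "M34_covers `` {M34_r} = {M34_s, M34_u}"
  "M34_covers `` {M34_s} = {M34_v, M34_w}"
  "M34_covers `` {M34_t} = {M34_v}"
  "M34_covers `` {M34_u} = {M34_w}"
  "M34_covers `` {M34_v} = {M34_1}"
  "M34_covers `` {M34_w} = {M34_1}"
  "M34_covers `` {M34_1} = {}"
  by (auto simp: M34_covers_def)

lemma M34_above_1:
  "(M34_1, y) \<in> M34_covers\<^sup>* \<longleftrightarrow>
     y \<in> {M34_1}"
  by (subst rtrancl_succs) (auto simp: M34_succs)

lemma M34_above_w:
  "(M34_w, y) \<in> M34_covers\<^sup>* \<longleftrightarrow>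
     y \<in> {M34_w, M34_1}"
  by (subst rtrancl_succs) (auto simp: M34_succs M34_above_1)

lemma M34_above_v:
  "(M34_v, y) \<in> M34_covers\<^sup>* \<longleftrightarrow>
     y \<in> {M34_v, M34_1}"
  by (subst rtrancl_succs) (auto simp: M34_succs M34_above_1)

lemma M34_above_u:
  "(M34_u, y) \<in> M34_covers\<^sup>* \<longleftrightarrow>
     y \<in> {M34_u, M34_w, M34_1}"
  by (subst rtrancl_succs) (auto simp: M34_succs M34_above_w)

lemma M34_above_t:
  "(M34_t, y) \<in> M34_covers\<^sup>* \<longleftrightarrow>
     y \<in> {M34_t, M34_v, M34_1}"
  by (subst rtrancl_succs) (auto simp: M34_succs M34_above_v)

lemma M34_above_s:
  "(M34_s, y) \<in> M34_covers\<^sup>* \<longleftrightarrow>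
     y \<in> {M34_s, M34_v, M34_w, M34_1}"
  by (subst rtrancl_succs) (auto simp: M34_succs M34_above_v M34_above_w)

lemma M34_above_r:
  "(M34_r, y) \<in> M34_covers\<^sup>* \<longleftrightarrow>
     y \<in> {M34_r, M34_s, M34_u, M34_v, M34_w, M34_1}"
  by (subst rtrancl_succs) (auto simp: M34_succs M34_above_s M34_above_u)

lemma M34_above_q:
  "(M34_q, y) \<in> M34_covers\<^sup>* \<longleftrightarrow>
     y \<in> {M34_q, M34_s, M34_v, M34_w, M34_1}"
  by (subst rtrancl_succs) (auto simp: M34_succs M34_above_s)

lemma M34_above_p:
  "(M34_p, y) \<in> M34_covers\<^sup>* \<longleftrightarrow>
     y \<in> {M34_p, M34_s, M34_t, M34_v, M34_w, M34_1}"
  by (subst rtrancl_succs) (auto simp: M34_succs M34_above_s M34_above_t)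

lemma M34_above_o:
  "(M34_o, y) \<in> M34_covers\<^sup>* \<longleftrightarrow>
     y \<in> {M34_o, M34_p, M34_q, M34_r, M34_s, M34_t, M34_u, M34_v, M34_w, M34_1}"
  by (subst rtrancl_succs) (auto simp: M34_succs M34_above_p M34_above_q M34_above_r)

lemmas M34_above =
  M34_above_1 M34_above_w M34_above_v M34_above_u M34_above_t
  M34_above_s M34_above_r M34_above_q M34_above_p M34_above_o

instantiation M34 :: order
begin

definition less_eq_M34 :: "M34 \<Rightarrow> M34 \<Rightarrow> bool" where
  "x \<le> y \<longleftrightarrow> (x, y) \<in> M34_covers\<^sup>*"

definition less_M34 :: "M34 \<Rightarrow> M34 \<Rightarrow> bool" where
  "x < y \<longleftrightarrow> x \<le> y \<and> \<not> y \<le> (x :: M34)"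

instance
proof
  fix x y :: M34
  show "x \<le> y \<Longrightarrow> y \<le> x \<Longrightarrow> x = y"
    unfolding less_eq_M34_def by (cases x; cases y; simp add: M34_above)
qed (auto simp: less_eq_M34_def less_M34_def)

end

lemma M34_inf_exists: "\<exists>z::M34. z \<le> x \<and> z \<le> y \<and> (\<forall>w. w \<le> x \<and> w \<le> y \<longrightarrow> w \<le> z)"
  by (cases x; cases y; simp add: M34_forall M34_exists less_eq_M34_def M34_above)

lemma M34_sup_exists: "\<exists>z::M34. x \<le> z \<and> y \<le> z \<and> (\<forall>w. x \<le> w \<and> y \<le> w \<longrightarrow> z \<le> w)"
  by (cases x; cases y; simp add: M34_forall M34_exists less_eq_M34_def M34_above)

instantiation M34 :: bounded_lattice_top
begin

definition inf_M34 :: "M34 \<Rightarrow> M34 \<Rightarrow> M34" where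
  "x \<sqinter> (y :: M34) = (GREATEST z. z \<le> x \<and> z \<le> y)"

definition sup_M34 :: "M34 \<Rightarrow> M34 \<Rightarrow> M34" where
  "x \<squnion> (y :: M34) = (LEAST z. x \<le> z \<and> y \<le> z)"

definition top_M34 :: M34 where
  "\<top> = M34_1"

instance
proof
  fix x y z :: M34
  have glb:
    "x \<sqinter> y \<le> x \<and> x \<sqinter> y \<le> y \<and> (\<forall>w. w \<le> x \<and> w \<le> y \<longrightarrow> w \<le> x \<sqinter> y)" for x y :: M34
    using M34_inf_exists[of x y] unfolding inf_M34_def 
    by (metis (mono_tags, lifting) Greatest_equality)
  have lub:
    "x \<le> x \<squnion> y \<and> y \<le> x \<squnion> y \<and> (\<forall>w. x \<le> w \<and> y \<le> w \<longrightarrow> x \<squnion> y \<le> w)" for x y :: M34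
    using M34_sup_exists[of x y] unfolding sup_M34_def 
    by (metis (mono_tags, lifting) Least_equality)
  show "x \<sqinter> y \<le> x" "x \<sqinter> y \<le> y"
    using glb by blast+
  show "x \<le> y \<Longrightarrow> x \<le> z \<Longrightarrow> x \<le> y \<sqinter> z"
    using glb by blast
  show "x \<le> x \<squnion> y" "y \<le> x \<squnion> y"
    using lub by blast+
  show "y \<le> x \<Longrightarrow> z \<le> x \<Longrightarrow> y \<squnion> z \<le> x"
    using lub by blast
  show "x \<le> \<top>"
    unfolding top_M34_def less_eq_M34_def by (cases x; simp add: M34_above)
qed

end

end

theory Submission
  imports Defs
begin

text \<open>
  If \<open>a \<squnion> b = \<top>\<close> and \<open>c\<close> violates distributivity, then the median elements of \<open>a, b, c\<close> bound a
  diamond. Together with \<open>a \<squnion> (b \<sqinter> c)\<close>, \<open>b \<squnion> (a \<sqinter> c)\<close>, \<open>a \<squnion> c\<close>, \<open>b \<squnion> c\<close> and \<open>\<top>\<close> it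
  forms a homomorphic image of \<open>M\<^bsub>3,4\<^esub>\<close> in which the diamond is not collapsed. The only possible
  collapses are \<open>p = t\<close> and \<open>r = u\<close>; one of them leads to \<open>M\<^bsub>3,2\<^esub>\<close>, both to \<open>M\<^sub>3\<close>. Conversely, each
  of the three lattices itself fails to be 1-distributive.
\<close>

section \<open>Embeddings preserving the top element\<close>

definition top_embedding :: "('b::bounded_lattice_top \<Rightarrow> 'a::bounded_lattice_top) \<Rightarrow> bool" where
  "top_embedding f \<longleftrightarrow> inj f \<and> f \<top> = \<top> \<and>
     (\<forall>x y. f (x \<sqinter> y) = f x \<sqinter> f y \<and> f (x \<squnion> y) = f x \<squnion> f y)"

text \<open>A 1-sublattice isomorphic to \<open>'b\<close> is the range of an embedding, namely the
  inverse of the isomorphism. Maps out of \<open>'b\<close> are easier to construct than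
  subsets.\<close>

lemma one_sublattice_isomorphic_iff_top_embedding:
  "(\<exists>S :: 'a::bounded_lattice_top set. one_sublattice S \<and>
      sublattice_isomorphic S TYPE('b::bounded_lattice_top)) \<longleftrightarrow>
   (\<exists>f :: 'b \<Rightarrow> 'a. top_embedding f)"
proof
  assume "\<exists>S :: 'a set. one_sublattice S \<and> sublattice_isomorphic S TYPE('b)"
  then obtain S :: "'a set" where S: "one_sublattice S" and "sublattice_isomorphic S TYPE('b)"
    by blast
  then obtain g :: "'a \<Rightarrow> 'b" where bij: "bij_betw g S UNIV"
    and hom: "\<forall>x\<in>S. \<forall>y\<in>S. g (x \<sqinter> y) = g x \<sqinter> g y \<and> g (x \<squnion> y) = g x \<squnion> g y"
    unfolding sublattice_isomorphic_def by auto
  define f where "f = inv_into S g"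
  have fS: "f x \<in> S" and gf: "g (f x) = x" for x
    using bij by (simp_all add: f_def bij_betw_def inv_into_into f_inv_into_f)
  have f_eq: "f x = y" if "y \<in> S" "g y = x" for x y
    using bij that by (auto simp: f_def bij_betw_def)
  have "f \<top> = \<top>"
  proof -
    have "\<top> \<in> S"
      using S by (simp add: one_sublattice_def)
    \<comment> \<open>\<open>sublattice_isomorphic\<close> says nothing about tops; applying
      \<open>g\<close> to \<open>f \<top> \<sqinter> \<top> = f \<top>\<close> gives this
      inequality.\<close>
    moreover from this have "\<top> \<le> g \<top>"
      using hom fS[of \<top>] gf[of \<top>] by (metis inf.absorb_iff1 inf_top_right)
    ultimately show ?thesis
      by (intro f_eq) (auto intro: top_le)
  qed
  moreover have "f (x \<sqinter> y) = f x \<sqinter> f y" "f (x \<squnion> y) = f x \<squnion> f y" for x y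
    using S by (auto intro!: f_eq simp: one_sublattice_def fS gf hom)
  moreover have "inj f"
    by (metis gf injI)
  ultimately show "\<exists>f :: 'b \<Rightarrow> 'a. top_embedding f"
    unfolding top_embedding_def by blast
next
  assume "\<exists>f :: 'b \<Rightarrow> 'a. top_embedding f"
  then obtain f :: "'b \<Rightarrow> 'a" where "inj f" and top: "f \<top> = \<top>"
    and hom: "\<And>x y. f (x \<sqinter> y) = f x \<sqinter> f y" "\<And>x y. f (x \<squnion> y) = f x \<squnion> f y"
    unfolding top_embedding_def by blast
  have "one_sublattice (range f)"
    unfolding one_sublattice_def by (auto simp flip: hom top)
  moreover have "sublattice_isomorphic (range f) TYPE('b)"
    unfolding sublattice_isomorphic_def
  proof (intro exI conjI)
    show "bij_betw (inv f) (range f) UNIV"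
      using \<open>inj f\<close> by (simp add: inj_imp_bij_betw_inv)
  qed (auto simp: \<open>inj f\<close> simp flip: hom)
  ultimately show "\<exists>S :: 'a set. one_sublattice S \<and> sublattice_isomorphic S TYPE('b)"
    by blast
qed

text \<open>The hypothesis \<open>a \<squnion> b = \<top>\<close> survives \<open>f\<close>, and
  injectivity pulls the resulting identity back. So a lattice that is not 1-distributive cannot
  embed into one that is.\<close>

lemma one_distributive_top_embedding:
  fixes f :: "'b::bounded_lattice_top \<Rightarrow> 'a::bounded_lattice_top"
  assumes "one_distributive TYPE('a)" and "top_embedding f"
  shows "one_distributive TYPE('b)"
  using assms unfolding one_distributive_def top_embedding_def by (metis injD)

text \<open>Monotonicity settles comparable pairs, so meets and joins need checking only at
  incomparable ones. Strictness on covers gives injectivity: if \<open>f x = f y\<close>, then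
  \<open>x \<sqinter> y\<close> has the same image, so it is strictly below neither.\<close>

lemma top_embeddingI:
  fixes f :: "'b::bounded_lattice_top \<Rightarrow> 'a::bounded_lattice_top"
  assumes le: "\<And>x y. x \<le> y \<longleftrightarrow> (x, y) \<in> R\<^sup>*"
    and cover: "\<And>x y. (x, y) \<in> R \<Longrightarrow> f x < f y"
    and top: "f \<top> = \<top>"
    and incomparable: "\<And>x y. \<not> x \<le> y \<Longrightarrow> \<not> y \<le> x \<Longrightarrow>
      f (x \<sqinter> y) = f x \<sqinter> f y \<and> f (x \<squnion> y) = f x \<squnion> f y"
  shows "top_embedding f"
proof -
  have mono: "f x \<le> f y" if "x \<le> y" for x y
    using that unfolding le by induction (auto dest: cover)
  have strict: "f x < f y" if "x < y" for x y
    using that le cover mono by (metis converse_rtranclE less_le_not_le order_less_le_trans)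
  have hom: "f (x \<sqinter> y) = f x \<sqinter> f y \<and> f (x \<squnion> y) = f x \<squnion> f y" for x y
    by (metis incomparable mono inf.absorb1 inf.absorb2 sup.absorb1 sup.absorb2)
  moreover have "inj f"
  proof (rule injI)
    fix x y
    assume "f x = f y"
    then have "f (x \<sqinter> y) = f x" "f (x \<sqinter> y) = f y"
      by (simp_all add: hom)
    then show "x = y"
      by (metis inf.cobounded1 inf.cobounded2 less_irrefl order_le_imp_less_or_eq strict)
  qed
  ultimately show ?thesis
    using top by (simp add: top_embedding_def)
qed

section \<open>Operation tables of the three lattices\<close>

text \<open>The bound is an object-level formula so that \<open>M3_forall\<close> and its analogues
  can expand it into finitely many cases.\<close>

lemma inf_eqI:
  fixes x y z :: "'a::lattice"
  assumes "z \<le> x" "z \<le> y" "\<forall>w. w \<le> x \<and> w \<le> y \<longrightarrow> w \<le> z"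
  shows "x \<sqinter> y = z"
  using assms by (simp add: antisym)

lemma sup_eqI:
  fixes x y z :: "'a::lattice"
  assumes "x \<le> z" "y \<le> z" "\<forall>w. x \<le> w \<and> y \<le> w \<longrightarrow> z \<le> w"
  shows "x \<squnion> y = z"
  using assms by (simp add: antisym)

text \<open>This and the following tables cover exactly the incomparable pairs, each in one order,
  as \<open>top_embeddingI\<close> requires.\<close>

lemma M3_inf:
  "M3_p \<sqinter> M3_q = M3_o" "M3_p \<sqinter> M3_r = M3_o"
  "M3_q \<sqinter> M3_r = M3_o"
  by (rule inf_eqI; simp add: M3_forall less_eq_M3_def M3_above)+

lemma M3_sup:
  "M3_p \<squnion> M3_q = M3_1" "M3_p \<squnion> M3_r = M3_1"
  "M3_q \<squnion> M3_r = M3_1"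
  by (rule sup_eqI; simp add: M3_forall less_eq_M3_def M3_above)+

lemma M32_inf:
  "M32_p \<sqinter> M32_q = M32_o" "M32_p \<sqinter> M32_r = M32_o"
  "M32_q \<sqinter> M32_r = M32_o" "M32_q \<sqinter> M32_t = M32_o"
  "M32_r \<sqinter> M32_t = M32_o" "M32_s \<sqinter> M32_t = M32_p"
  by (rule inf_eqI; simp add: M32_forall less_eq_M32_def M32_above)+

lemma M32_sup:
  "M32_p \<squnion> M32_q = M32_s" "M32_p \<squnion> M32_r = M32_s"
  "M32_q \<squnion> M32_r = M32_s" "M32_q \<squnion> M32_t = M32_1"
  "M32_r \<squnion> M32_t = M32_1" "M32_s \<squnion> M32_t = M32_1"
  by (rule sup_eqI; simp add: M32_forall less_eq_M32_def M32_above)+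

lemma M34_inf:
  "M34_p \<sqinter> M34_q = M34_o" "M34_p \<sqinter> M34_r = M34_o"
  "M34_p \<sqinter> M34_u = M34_o" "M34_q \<sqinter> M34_r = M34_o"
  "M34_q \<sqinter> M34_t = M34_o" "M34_q \<sqinter> M34_u = M34_o"
  "M34_r \<sqinter> M34_t = M34_o" "M34_s \<sqinter> M34_t = M34_p"
  "M34_s \<sqinter> M34_u = M34_r" "M34_t \<sqinter> M34_u = M34_o"
  "M34_t \<sqinter> M34_w = M34_p" "M34_u \<sqinter> M34_v = M34_r"
  "M34_v \<sqinter> M34_w = M34_s"
  by (rule inf_eqI; simp add: M34_forall less_eq_M34_def M34_above)+

lemma M34_sup:
  "M34_p \<squnion> M34_q = M34_s" "M34_p \<squnion> M34_r = M34_s"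
  "M34_p \<squnion> M34_u = M34_w" "M34_q \<squnion> M34_r = M34_s"
  "M34_q \<squnion> M34_t = M34_v" "M34_q \<squnion> M34_u = M34_w"
  "M34_r \<squnion> M34_t = M34_v" "M34_s \<squnion> M34_t = M34_v"
  "M34_s \<squnion> M34_u = M34_w" "M34_t \<squnion> M34_u = M34_1"
  "M34_t \<squnion> M34_w = M34_1" "M34_u \<squnion> M34_v = M34_1"
  "M34_v \<squnion> M34_w = M34_1"
  by (rule sup_eqI; simp add: M34_forall less_eq_M34_def M34_above)+

section \<open>Failure of 1-distributivity in the three lattices\<close>

lemma M3_not_one_distributive: "\<not> one_distributive TYPE(M3)"
proof -
  have "M3_p \<squnion> M3_q = \<top>" "M3_r \<sqinter> (M3_p \<squnion> M3_q) \<noteq> (M3_r \<sqinter> M3_p) \<squnion> (M3_r \<sqinter> M3_q)"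
    by (simp_all add: top_M3_def M3_sup M3_inf inf_commute[of M3_r] flip: top_M3_def)
  then show ?thesis
    unfolding one_distributive_def by blast
qed

lemma M32_not_one_distributive: "\<not> one_distributive TYPE(M32)"
proof -
  \<comment> \<open>Two atoms no longer join to the top; \<open>M32_t\<close> takes the place of
    \<open>M32_p\<close>.\<close>
  have "M32_q \<squnion> M32_t = \<top>" "M32_r \<sqinter> (M32_q \<squnion> M32_t) \<noteq> (M32_r \<sqinter> M32_q) \<squnion> (M32_r \<sqinter> M32_t)"
    by (simp_all add: top_M32_def M32_sup M32_inf inf_commute[of M32_r M32_q] flip: top_M32_def)
  then show ?thesis
    unfolding one_distributive_def by blast
qed

lemma M34_not_one_distributive: "\<not> one_distributive TYPE(M34)"
proof -
  have "M34_t \<squnion> M34_u = \<top>" "M34_q \<sqinter> (M34_t \<squnion> M34_u) \<noteq> (M34_q \<sqinter> M34_t) \<squnion> (M34_q \<sqinter> M34_u)"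
    by (simp_all add: top_M34_def M34_sup M34_inf flip: top_M34_def)
  then show ?thesis
    unfolding one_distributive_def by blast
qed

section \<open>Recognizing the three lattices\<close>

text \<open>One equality collapses the diamond: if \<open>z = p\<close>, then \<open>p\<close> lies
  below \<open>q\<close> and \<open>r\<close>, so both equal \<open>s\<close> and
  \<open>z = q \<sqinter> r = s\<close>. The other cases are symmetric or dual.\<close>

lemma diamond_less:
  fixes z p q r s :: "'a::lattice"
  assumes "p \<sqinter> q = z" "p \<sqinter> r = z" "q \<sqinter> r = z" "p \<squnion> q = s" "p \<squnion> r = s" "q \<squnion> r = s" "z \<noteq> s"
  shows "z < p" "z < q" "z < r" "p < s" "q < s" "r < s"
proof -
  have "z \<le> p" "z \<le> q" "z \<le> r" "p \<le> s" "q \<le> s" "r \<le> s"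
    using assms by (metis inf.cobounded1 inf.cobounded2 sup.cobounded1 sup.cobounded2)+
  moreover have "z \<noteq> p" "z \<noteq> q" "z \<noteq> r" "p \<noteq> s" "q \<noteq> s" "r \<noteq> s"
    using assms by (metis inf.idem inf_commute inf_sup_absorb sup.idem sup_commute sup_inf_absorb)+
  ultimately show "z < p" "z < q" "z < r" "p < s" "q < s" "r < s"
    by simp_all
qed

lemma M3_top_embedding:
  fixes z p q r :: "'a::bounded_lattice_top"
  assumes inf: "p \<sqinter> q = z" "p \<sqinter> r = z" "q \<sqinter> r = z"
    and sup: "p \<squnion> q = \<top>" "p \<squnion> r = \<top>" "q \<squnion> r = \<top>"
    and ne: "z \<noteq> \<top>"
  shows "\<exists>f :: M3 \<Rightarrow> 'a. top_embedding f"
proof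
  define f where "f x = (case x of M3_o \<Rightarrow> z | M3_p \<Rightarrow> p | M3_q \<Rightarrow> q | M3_r \<Rightarrow> r | M3_1 \<Rightarrow> \<top>)" for x
  note less = diamond_less[OF inf sup ne]
  show "top_embedding f"
  proof (rule top_embeddingI)
    show "x \<le> y \<longleftrightarrow> (x, y) \<in> M3_covers\<^sup>*" for x y
      by (rule less_eq_M3_def)
    show "f x < f y" if "(x, y) \<in> M3_covers" for x y
      using that less by (auto simp: M3_covers_def f_def)
    show "f \<top> = \<top>"
      by (simp add: top_M3_def f_def)
    show "f (x \<sqinter> y) = f x \<sqinter> f y \<and> f (x \<squnion> y) = f x \<squnion> f y" if "\<not> x \<le> y" "\<not> y \<le> x" for x y
      using that inf sup
      by (cases x; cases y; simp add: less_eq_M3_def M3_above)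
        (simp_all add: f_def M3_inf M3_sup
          inf_commute sup_commute)
  qed
qed

lemma M32_top_embedding:
  fixes z p q r s t :: "'a::bounded_lattice_top"
  assumes inf: "p \<sqinter> q = z" "p \<sqinter> r = z" "q \<sqinter> r = z"
    and sup: "p \<squnion> q = s" "p \<squnion> r = s" "q \<squnion> r = s"
    and ne: "z \<noteq> s"
    and t: "s \<sqinter> t = p" "s \<squnion> t = \<top>" "p \<noteq> t"
  shows "\<exists>f :: M32 \<Rightarrow> 'a. top_embedding f"
proof
  define f where "f x = (case x of M32_o \<Rightarrow> z | M32_p \<Rightarrow> p | M32_q \<Rightarrow> q | M32_r \<Rightarrow> r |
    M32_s \<Rightarrow> s | M32_t \<Rightarrow> t | M32_1 \<Rightarrow> \<top>)" for x
  note less = diamond_less[OF inf sup ne]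
  \<comment> \<open>\<open>s = \<top>\<close> would give \<open>p = t\<close>, and
    \<open>t = \<top>\<close> would give \<open>p = s\<close>.\<close>
  have less': "p < t" "s < \<top>" "t < \<top>"
    using t less by (metis inf.cobounded2 inf_top_left inf_top_right less_irrefl
        order_le_imp_less_or_eq top.not_eq_extremum)+
  \<comment> \<open>Since \<open>q \<le> s\<close>, \<open>q \<sqinter> t = q \<sqinter> (s
    \<sqinter> t) = q \<sqinter> p\<close>.\<close>
  have inf': "q \<sqinter> t = z" "r \<sqinter> t = z"
    by (metis inf t(1) less less_imp_le inf.absorb1 inf_assoc inf_commute)+
  have sup': "q \<squnion> t = \<top>" "r \<squnion> t = \<top>"
    by (metis sup t(2) less'(1) less_imp_le sup.absorb2 sup_assoc sup_commute)+
  show "top_embedding f"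
  proof (rule top_embeddingI)
    show "x \<le> y \<longleftrightarrow> (x, y) \<in> M32_covers\<^sup>*" for x y
      by (rule less_eq_M32_def)
    show "f x < f y" if "(x, y) \<in> M32_covers" for x y
      using that less less' by (auto simp: M32_covers_def f_def)
    show "f \<top> = \<top>"
      by (simp add: top_M32_def f_def)
    show "f (x \<sqinter> y) = f x \<sqinter> f y \<and> f (x \<squnion> y) = f x \<squnion> f y"
      if "\<not> x \<le> y" "\<not> y \<le> x" for x y
      using that inf sup t(1,2) inf' sup'
      by (cases x; cases y; simp add: less_eq_M32_def M32_above)
        (simp_all add: f_def M32_inf M32_sup inf_commute sup_commute)
  qed
qed

lemma M34_top_embedding:
  fixes z p q r s t u v w :: "'a::bounded_lattice_top"
  assumes inf: "p \<sqinter> q = z" "p \<sqinter> r = z" "q \<sqinter> r = z"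
    and sup: "p \<squnion> q = s" "p \<squnion> r = s" "q \<squnion> r = s"
    and ne: "z \<noteq> s"
    and t: "s \<sqinter> t = p" "s \<squnion> t = v" "p \<noteq> t"
    and u: "s \<sqinter> u = r" "s \<squnion> u = w" "r \<noteq> u"
    and vw: "v \<sqinter> w = s" "t \<squnion> u = \<top>"
  shows "\<exists>f :: M34 \<Rightarrow> 'a. top_embedding f"
proof
  define f where "f x = (case x of M34_o \<Rightarrow> z | M34_p \<Rightarrow> p | M34_q \<Rightarrow> q | M34_r \<Rightarrow> r |
    M34_s \<Rightarrow> s | M34_t \<Rightarrow> t | M34_u \<Rightarrow> u | M34_v \<Rightarrow> v | M34_w \<Rightarrow> w | M34_1 \<Rightarrow> \<top>)" for x
  note less = diamond_less[OF inf sup ne]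
  have le: "p \<le> t" "r \<le> u" "s \<le> v" "s \<le> w" "t \<le> v" "u \<le> w"
    using t u by auto
  have inf_w: "t \<sqinter> w = p"
    by (metis le(5) t(1) vw(1) inf.absorb1 inf_assoc inf_commute)
  have inf_v: "u \<sqinter> v = r"
    by (metis le(6) u(1) vw(1) inf.absorb1 inf_assoc inf_commute)
  \<comment> \<open>For the last one, \<open>u \<le> w\<close> reduces \<open>t \<sqinter> u\<close>
    to \<open>p \<sqinter> u\<close>, which is \<open>p \<sqinter> r\<close> because
    \<open>p \<le> s\<close>.\<close>
  have inf': "q \<sqinter> t = z" "r \<sqinter> t = z" "p \<sqinter> u = z" "q \<sqinter> u = z" "t \<sqinter> u = z"
    by (metis inf t(1) u(1) less less_imp_le inf.absorb1 inf_assoc inf_commute inf_w le(6))+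
  have sup': "q \<squnion> t = v" "r \<squnion> t = v" "p \<squnion> u = w" "q \<squnion> u = w"
    by (metis sup t(2) u(2) le(1,2) sup.absorb2 sup_assoc sup_commute)+
  have sup_top: "t \<squnion> w = \<top>" "u \<squnion> v = \<top>" "v \<squnion> w = \<top>"
  proof -
    have "t \<squnion> u \<le> t \<squnion> w" "t \<squnion> u \<le> u \<squnion> v" "t \<squnion> u \<le> v \<squnion> w"
      using le by (auto intro: le_supI1 le_supI2)
    then show "t \<squnion> w = \<top>" "u \<squnion> v = \<top>" "v \<squnion> w = \<top>"
      by (simp_all add: vw(2) top_unique)
  qed
  \<comment> \<open>\<open>s = v\<close> would put \<open>t\<close> below \<open>s\<close>, forcing
    \<open>p = t\<close>.\<close>
  have ne': "s \<noteq> v" "s \<noteq> w"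
    using t(1,3) u(1,3) le(5,6) by (auto simp: inf.absorb2)
  \<comment> \<open>\<open>t = v\<close> would give \<open>p = s\<close>, and
    \<open>v = \<top>\<close> would give \<open>s = w\<close>.\<close>
  then have "t \<noteq> v" "u \<noteq> w" "v \<noteq> \<top>" "w \<noteq> \<top>"
    using t(1) u(1) less le(3,4) vw(1) by (auto simp: inf.absorb1)
  note ne' = ne' this
  have less': "p < t" "r < u" "s < v" "s < w" "t < v" "u < w" "v < \<top>" "w < \<top>"
    using le ne' t(3) u(3) by (simp_all add: less_le)
  show "top_embedding f"
  proof (rule top_embeddingI)
    show "x \<le> y \<longleftrightarrow> (x, y) \<in> M34_covers\<^sup>*" for x y
      by (rule less_eq_M34_def)
    show "f x < f y" if "(x, y) \<in> M34_covers" for x y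
      using that less less' by (auto simp: M34_covers_def f_def)
    show "f \<top> = \<top>"
      by (simp add: top_M34_def f_def)
    show "f (x \<sqinter> y) = f x \<sqinter> f y \<and> f (x \<squnion> y) = f x \<squnion> f y"
      if "\<not> x \<le> y" "\<not> y \<le> x" for x y
      using that inf sup t(1,2) u(1,2) vw inf_w inf_v inf' sup' sup_top
      by (cases x; cases y; simp add: less_eq_M34_def M34_above)
        (simp_all add: f_def M34_inf M34_sup inf_commute sup_commute)
  qed
qed

section \<open>Median elements in modular lattices\<close>

lemma modular_law:
  fixes x y w :: "'a::lattice"
  assumes "modular_lattice TYPE('a)" and "x \<le> w"
  shows "x \<squnion> (y \<sqinter> w) = (x \<squnion> y) \<sqinter> w"
  using assms by (simp add: modular_lattice_def)

text \<open>The modular law is applied twice: \<open>a \<sqinter> c\<close> lies below the first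
  factor and is pulled out of the meet, then \<open>b \<sqinter> c \<le> b\<close> evaluates the
  rest. The right side is symmetric, so permuted instances share one value.\<close>

lemma modular_inf_median:
  fixes a b c :: "'a::lattice"
  assumes M: "modular_lattice TYPE('a)"
  shows "(a \<squnion> (b \<sqinter> c)) \<sqinter> (b \<squnion> (a \<sqinter> c)) = (a \<sqinter> b) \<squnion> (b \<sqinter> c) \<squnion> (c \<sqinter> a)"
proof -
  have "(a \<squnion> (b \<sqinter> c)) \<sqinter> b = (b \<sqinter> c) \<squnion> (a \<sqinter> b)"
    using modular_law[OF M, of "b \<sqinter> c" b a] by (simp add: sup_commute)
  moreover have "a \<sqinter> c \<le> a \<squnion> (b \<sqinter> c)"
    by (simp add: le_supI1)
  ultimately show ?thesis
    using modular_law[OF M, of "a \<sqinter> c" "a \<squnion> (b \<sqinter> c)" b]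
    by (simp add: ac_simps)
qed

lemma modular_sup_median:
  fixes a b c :: "'a::lattice"
  assumes M: "modular_lattice TYPE('a)"
  shows "(a \<sqinter> (b \<squnion> c)) \<squnion> (b \<sqinter> (a \<squnion> c)) = (a \<squnion> b) \<sqinter> (b \<squnion> c) \<sqinter> (c \<squnion> a)"
proof -
  have "(a \<sqinter> (b \<squnion> c)) \<squnion> b = (b \<squnion> c) \<sqinter> (a \<squnion> b)"
    using modular_law[OF M, of b "b \<squnion> c" a] by (simp add: ac_simps)
  moreover have "a \<sqinter> (b \<squnion> c) \<le> a \<squnion> c"
    by (simp add: le_infI1)
  ultimately show ?thesis
    using modular_law[OF M, of "a \<sqinter> (b \<squnion> c)" "a \<squnion> c" b]
    by (simp add: ac_simps)
qed

text \<open>The median identities supply the meets and joins; the failure of distributivity at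
  \<open>c\<close> enters through \<open>z \<noteq> s\<close>.\<close>

lemma not_one_distributive_top_embedding:
  assumes M: "modular_lattice TYPE('a::bounded_lattice_top)"
    and "\<not> one_distributive TYPE('a)"
  shows "(\<exists>f :: M3 \<Rightarrow> 'a. top_embedding f) \<or> (\<exists>f :: M32 \<Rightarrow> 'a. top_embedding f) \<or>
    (\<exists>f :: M34 \<Rightarrow> 'a. top_embedding f)"
proof -
  obtain a b c :: 'a where ab: "a \<squnion> b = \<top>" and c: "c \<noteq> (c \<sqinter> a) \<squnion> (c \<sqinter> b)"
    using assms(2) unfolding one_distributive_def by auto
  \<comment> \<open>\<open>z\<close> is the lower median and, because
    \<open>a \<squnion> b = \<top>\<close>, \<open>s\<close> is the upper one. The atoms
    \<open>p\<close>, \<open>r\<close>, \<open>q\<close> are the projections of \<open>a\<close>,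
    \<open>b\<close>, \<open>c\<close> into the interval between them.\<close>
  define z where "z = (a \<sqinter> b) \<squnion> (b \<sqinter> c) \<squnion> (c \<sqinter> a)"
  define v where "v = a \<squnion> c"
  define w where "w = b \<squnion> c"
  define s where "s = v \<sqinter> w"
  define t where "t = a \<squnion> (b \<sqinter> c)"
  define u where "u = b \<squnion> (a \<sqinter> c)"
  define p where "p = t \<sqinter> w"
  define q where "q = c \<squnion> (a \<sqinter> b)"
  define r where "r = u \<sqinter> v"
  have tv: "t \<le> v" and uw: "u \<le> w" and qs: "q \<le> s"
    by (auto simp: t_def u_def v_def w_def q_def s_def le_infI1 le_infI2 le_supI1 le_supI2)
  have tu: "t \<sqinter> u = z" and tq: "t \<sqinter> q = z" and uq: "u \<sqinter> q = z"
    using modular_inf_median[OF M, of a b c] modular_inf_median[OF M, of a c b]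
      modular_inf_median[OF M, of b c a]
    by (simp_all add: t_def u_def q_def z_def ac_simps)
  \<comment> \<open>Writing \<open>p\<close> and \<open>r\<close> as joins makes it possible to
    bound \<open>s\<close> by joins of atoms.\<close>
  have p': "p = (b \<sqinter> c) \<squnion> (a \<sqinter> w)"
    using modular_law[OF M, of "b \<sqinter> c" w a]
    by (simp add: p_def t_def w_def le_infI1 le_supI1 ac_simps)
  have r': "r = (a \<sqinter> c) \<squnion> (b \<sqinter> v)"
    using modular_law[OF M, of "a \<sqinter> c" v b]
    by (simp add: r_def u_def v_def le_infI1 le_supI1 ac_simps)
  have ps: "p \<le> s" and rs: "r \<le> s"
    using tv uw by (auto simp: p_def r_def s_def le_infI1)
  have s1: "s \<le> p \<squnion> r"
  proof -
    have "s = (a \<sqinter> w) \<squnion> (b \<sqinter> v)"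
      using modular_sup_median[OF M, of a b c] ab by (simp add: s_def v_def w_def ac_simps)
    then show ?thesis
      unfolding p' r' by (auto intro: le_supI1 le_supI2)
  qed
  have s2: "s \<le> p \<squnion> q"
  proof -
    \<comment> \<open>The second summand \<open>c \<sqinter> (a \<squnion> b)\<close> of the median
      identity is just \<open>c\<close>.\<close>
    have "s = (a \<sqinter> w) \<squnion> c"
      using modular_sup_median[OF M, of a c b] ab by (simp add: s_def v_def w_def ac_simps)
    then show ?thesis
      unfolding p' q_def by (auto intro: le_supI1 le_supI2)
  qed
  have s3: "s \<le> q \<squnion> r"
  proof -
    have "s = (b \<sqinter> v) \<squnion> c"
      using modular_sup_median[OF M, of b c a] ab by (simp add: s_def v_def w_def ac_simps)
    then show ?thesis
      unfolding r' q_def by (auto intro: le_supI1 le_supI2)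
  qed
  have sup: "p \<squnion> q = s" "p \<squnion> r = s" "q \<squnion> r = s"
    using s1 s2 s3 ps qs rs by (auto intro: antisym)
  have inf: "p \<sqinter> q = z" "p \<sqinter> r = z" "q \<sqinter> r = z"
  proof -
    \<comment> \<open>As \<open>q\<close> lies below \<open>v\<close> and \<open>w\<close>, these
      factors disappear, leaving \<open>t \<sqinter> q\<close> and
      \<open>u \<sqinter> q\<close>.\<close>
    show "p \<sqinter> q = z" "q \<sqinter> r = z"
      using qs tq uq unfolding p_def r_def s_def
      by (metis inf.absorb2 inf.boundedE inf_assoc inf_commute)+
    show "p \<sqinter> r = z"
      using tu tv uw unfolding p_def r_def
      by (metis inf.absorb1 inf_assoc inf_commute)
  qed
  have t: "s \<sqinter> t = p" and u: "s \<sqinter> u = r"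
    using tv uw unfolding s_def p_def r_def by (metis inf.absorb1 inf_assoc inf_commute)+
  have t': "s \<squnion> t = v"
  proof (rule antisym)
    \<comment> \<open>By modularity \<open>a \<squnion> s = (a \<squnion> w) \<sqinter> v\<close>,
      and \<open>a \<squnion> w\<close> is the top because \<open>b \<le> w\<close>.\<close>
    have "v = a \<squnion> s"
      using modular_law[OF M, of a v w] ab
      by (simp add: s_def v_def w_def ac_simps flip: sup_assoc)
    also have "\<dots> \<le> s \<squnion> t"
      by (auto simp: t_def intro: le_supI2)
    finally show "v \<le> s \<squnion> t" .
  qed (use tv in \<open>simp add: s_def\<close>)
  have u': "s \<squnion> u = w"
  proof (rule antisym)
    have "w = b \<squnion> s"
      using modular_law[OF M, of b w v] ab
      by (simp add: s_def v_def w_def ac_simps flip: sup_assoc)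
    also have "\<dots> \<le> s \<squnion> u"
      by (auto simp: u_def intro: le_supI2)
    finally show "w \<le> s \<squnion> u" .
  qed (use uw in \<open>simp add: s_def\<close>)
  have tu': "t \<squnion> u = \<top>"
    using ab by (metis sup_top_left sup_assoc sup_commute t_def u_def)
  have ne: "z \<noteq> s"
  proof
    assume "z = s"
    then have "c \<le> z"
      by (simp add: s_def v_def w_def)
    \<comment> \<open>The added term is absorbed; with it, the modular law below \<open>c\<close>
      turns the expression into \<open>z \<sqinter> c\<close>, which is \<open>c\<close>.\<close>
    have "(c \<sqinter> a) \<squnion> (c \<sqinter> b) = ((c \<sqinter> a) \<squnion> (c \<sqinter> b)) \<squnion> ((a \<sqinter> b) \<sqinter> c)"
      by (rule antisym) (auto simp: le_infI1 le_infI2 le_supI1 le_supI2)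
    also have "\<dots> = z \<sqinter> c"
      by (subst modular_law[OF M]) (simp_all add: z_def ac_simps)
    finally show False
      using \<open>c \<le> z\<close> c by (simp add: inf.absorb2)
  qed
  \<comment> \<open>The diamond with \<open>p\<close> and \<open>r\<close> exchanged, for the case
    where the extra element \<open>u\<close> sits above \<open>r\<close>.\<close>
  have inf_r: "r \<sqinter> q = z" "r \<sqinter> p = z" "q \<sqinter> p = z"
    and sup_r: "r \<squnion> q = s" "r \<squnion> p = s" "q \<squnion> p = s"
    using inf sup by (simp_all add: ac_simps)
  have vw: "v \<squnion> w = \<top>"
    using tu' tv uw by (metis sup.mono top.extremum_unique)
  consider "p = t" "r = u" | "p = t" "r \<noteq> u" | "p \<noteq> t" "r = u" | "p \<noteq> t" "r \<noteq> u"
    by blast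
  then show ?thesis
  proof cases
    case 1
    then have "s = \<top>"
      using sup(2) tu' by simp
    then show ?thesis
      using M3_top_embedding[OF inf] sup ne by simp
  next
    case 2
    \<comment> \<open>\<open>t = p \<le> s\<close> gives \<open>v = s \<le> w\<close>, so
      \<open>w = v \<squnion> w = \<top>\<close>.\<close>
    then have "s \<squnion> u = \<top>"
      using ps t' u' vw by (metis sup.absorb1 sup.absorb2 inf.cobounded2 s_def)
    then show ?thesis
      using M32_top_embedding[OF inf_r sup_r ne u] 2 by blast
  next
    case 3
    then have "s \<squnion> t = \<top>"
      using rs t' u' vw by (metis sup.absorb1 sup.absorb2 inf.cobounded1 s_def)
    then show ?thesis
      using M32_top_embedding[OF inf sup ne t] 3 by blast
  next
    case 4
    then show ?thesis
      using M34_top_embedding[OF inf sup ne t t' _ u u' _ s_def[symmetric] tu'] by blast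
  qed
qed

theorem theorem4p2:
  assumes "finite (UNIV :: 'a::bounded_lattice_top set)"
    and "card (UNIV :: 'a set) \<ge> 2"
    and "modular_lattice TYPE('a)"
  shows "one_distributive TYPE('a) \<longleftrightarrow>
    \<not> (\<exists>S :: 'a set. one_sublattice S \<and>
          (sublattice_isomorphic S TYPE(M3) \<or>
           sublattice_isomorphic S TYPE(M32) \<or>
           sublattice_isomorphic S TYPE(M34)))"
proof -
  have "one_distributive TYPE('a) \<longleftrightarrow>
    \<not> ((\<exists>f :: M3 \<Rightarrow> 'a. top_embedding f) \<or> (\<exists>f :: M32 \<Rightarrow> 'a. top_embedding f) \<or>
       (\<exists>f :: M34 \<Rightarrow> 'a. top_embedding f))"
    using not_one_distributive_top_embedding[OF assms(3)] one_distributive_top_embedding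
      M3_not_one_distributive M32_not_one_distributive M34_not_one_distributive by metis
  then show ?thesis
    unfolding one_sublattice_isomorphic_iff_top_embedding[symmetric] by blast
qed

end
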